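(* Let $X=(X_n)_{n\in\mathbb{Z}}$ be the i.i.d. increments of a skip-free to the left random walk, let $\mathbb{Z}^R$ be the record graph of $(\mathbb{Z},X)$ and let $[\mathbf{T},0]$ be the connected component of $0$ (rooted at $0$) in $\mathbb{Z}^R$. If $0<\mathbb{E}[X_0]<\infty$, then almost surely the record graph $\mathbb{Z}^R$ is connected and the unimodular Family Tree $[\mathbf{T},0]$ is of class $\mathcal{I}/\mathcal{F}$.
   Context: **Increments.** "I.i.d. increments of a skip-free to the left random walk" means: $X=(X_n)_{n\in\mathbb{Z}}$ is i.i.d., each $X_n$ takes values in $\{-1,0,1,2,\dots\}$, $\mathbb{P}[X_0=-1]>0$ and $\mathbb{E}[X_0]<\infty$. **Record graph.** For an integer-valued sequence $x$ the record map is $R_x(i)=\inf\{j>i:\sum_{l=i}^{j-1}x_l\ge 0\}$ if the infimum exists and $R_x(i)=i$ otherwise. The record graph of $(\mathbb{Z},x)$ is the directed graph on $\mathbb{Z}$ with edges $(i,R_x(i))$ for all $i$ with $R_x(i)\ne i$; "connected" refers to the underlying undirected graph. **Class $\mathcal{I}/\mathcal{F}$.** In a Family Tree (locally finite directed tree with out-degrees at most $1$), let $F$ map each vertex to its parent (the endpoint of its outgoing edge) if it exists, and to itself otherwise. The foil of a vertex $u$ is $\{v: F^n(v)=F^n(u)\text{ for some }n\ge0\}$. The tree is of class $\mathcal{I}/\mathcal{F}$ if it is infinite and all its foils are finite. For unimodular Family Trees this is (known to be) equivalent to: the tree is eternal (every vertex has a parent), two-ended, and the vertices with infinitely many descendants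 form a unique bi-infinite directed path. (The tree $[\mathbf{T},0]$ is unimodular, i.e. satisfies the Mass Transport Principle; this is known because $X$ is stationary.) *)

theory Defs
  imports "HOL-Probability.Probability" "Graph_Theory.Graph_Theory"
begin

locale skip_free_increments = prob_space M for M :: "'w measure" +
  fixes X :: "int \<Rightarrow> 'w \<Rightarrow> int"
  assumes independent: "indep_vars (\<lambda>_. count_space UNIV) X UNIV"
    and identically_distributed:
      "\<And>n. distr M (count_space UNIV) (X n) = distr M (count_space UNIV) (X 0)"
    and skip_free: "\<And>n. AE \<omega> in M. - 1 \<le> X n \<omega>"
    and down_step: "0 < prob {\<omega> \<in> space M. X 0 \<omega> = - 1}"
    and finite_mean: "integrable M (\<lambda>\<omega>. real_of_int (X 0 \<omega>))"

definition record_map :: "(int \<Rightarrow> int) \<Rightarrow> int \<Rightarrow> int" where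
  "record_map x i =
    (if \<exists>j>i. 0 \<le> (\<Sum>l\<in>{i..<j}. x l) then Inf {j. i < j \<and> 0 \<le> (\<Sum>l\<in>{i..<j}. x l)} else i)"

definition record_graph :: "(int \<Rightarrow> int) \<Rightarrow> (int, int \<times> int) pre_digraph" where
  "record_graph x = with_proj
     \<lparr>pverts = UNIV, parcs = {(i, record_map x i) | i. record_map x i \<noteq> i}\<rparr>"

text \<open>\<^const>\<open>mk_symmetric\<close> is the underlying undirected graph, so the component is the weak one.\<close>

definition component_of :: "('v, 'e) pre_digraph \<Rightarrow> 'v \<Rightarrow> ('v, 'e) pre_digraph" where
  "component_of G u = induce_subgraph G {v. reachable (mk_symmetric G) u v}"

text \<open>
  The tree condition concerns the underlying undirected graph: it is connected, it has no
  loops, parallel or antiparallel arcs, and it has no cycles. Each undirected edge is a pair of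
  opposite arcs of \<^term>\<open>mk_symmetric G\<close>, so the closed walks \<open>u, v, u\<close> of length two are not
  cycles. The predicate \<open>tree\<close> of the graph library only excludes directed cycles.
\<close>

definition directed_tree :: "('v, 'e) pre_digraph \<Rightarrow> bool" where
  "directed_tree G \<longleftrightarrow>
     nomulti_digraph G \<and> loopfree_digraph G \<and> asym (arcs_ends G) \<and>
     Digraph_Component.connected G \<and>
     \<not> (\<exists>p. pre_digraph.cycle (with_proj (mk_symmetric G)) p \<and> 3 \<le> length p)"

definition locally_finite :: "('v, 'e) pre_digraph \<Rightarrow> bool" where
  "locally_finite G \<longleftrightarrow> (\<forall>v\<in>verts G. finite (in_arcs G v) \<and> finite (out_arcs G v))"

definition family_tree :: "('v, 'e) pre_digraph \<Rightarrow> bool" where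
  "family_tree G \<longleftrightarrow>
     directed_tree G \<and> locally_finite G \<and> (\<forall>v\<in>verts G. out_degree G v \<le> 1)"

definition parent :: "('v, 'e) pre_digraph \<Rightarrow> 'v \<Rightarrow> 'v" where
  "parent G u = (if \<exists>v. u \<rightarrow>\<^bsub>G\<^esub> v then THE v. u \<rightarrow>\<^bsub>G\<^esub> v else u)"

definition foil :: "('v, 'e) pre_digraph \<Rightarrow> 'v \<Rightarrow> 'v set" where
  "foil G u = {v \<in> verts G. \<exists>n. (parent G ^^ n) v = (parent G ^^ n) u}"

definition class_I_F :: "('v, 'e) pre_digraph \<Rightarrow> bool" where
  "class_I_F G \<longleftrightarrow> family_tree G \<and> infinite (verts G) \<and> (\<forall>u\<in>verts G. finite (foil G u))"

text \<open>
  Unimodularity is the Mass Transport Principle. Random rooted graphs are represented by graphs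
  with labels in a countable type. Test functions on isomorphism classes of doubly rooted
  graphs become functions of labelled graphs that are invariant under isomorphism; for
  connected locally finite graphs, the Borel sets of the local topology pull back to sets in
  the sigma-algebra generated by the events that a given vertex or arc is present.
\<close>

definition graph_space :: "('v::countable, 'e) pre_digraph measure" where
  "graph_space = sigma UNIV
     (range (\<lambda>u. {G. u \<in> verts G}) \<union> range (\<lambda>(u, v). {G. u \<rightarrow>\<^bsub>G\<^esub> v}))"

definition mass_transport :: "(('v::countable, 'e) pre_digraph \<Rightarrow> 'v \<Rightarrow> 'v \<Rightarrow> ennreal) \<Rightarrow> bool" where
  "mass_transport g \<longleftrightarrow>
     (\<forall>u v. (\<lambda>G. g G u v) \<in> borel_measurable graph_space) \<and>
     (\<forall>G h. \<forall>u\<in>verts G. \<forall>v\<in>verts G. pre_digraph.digraph_isomorphism G h \<longrightarrow>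
        g (app_iso h G) (iso_verts h u) (iso_verts h v) = g G u v)"

definition unimodular ::
  "'w measure \<Rightarrow> ('w \<Rightarrow> ('v::countable, 'e) pre_digraph) \<Rightarrow> 'v \<Rightarrow> bool" where
  "unimodular M T r \<longleftrightarrow>
     T \<in> measurable M graph_space \<and> (\<forall>\<omega>\<in>space M. r \<in> verts (T \<omega>)) \<and>
     (\<forall>g. mass_transport g \<longrightarrow>
        (\<integral>\<^sup>+ \<omega>. (\<integral>\<^sup>+ v. g (T \<omega>) r v \<partial>count_space (verts (T \<omega>))) \<partial>M) =
        (\<integral>\<^sup>+ \<omega>. (\<integral>\<^sup>+ v. g (T \<omega>) v r \<partial>count_space (verts (T \<omega>))) \<partial>M))"

end

theory Submission
  imports Defs
begin

text \<open>
  Let \<open>S\<close> be the walk with increments \<open>X\<close>. Since \<open>X \<ge> -1\<close> and the mean is positive,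
  \<open>E (exp (- t X)) < 1\<close> for some small \<open>t > 0\<close>. So \<open>exp (- t (S (i + n) - S i))\<close> and
  \<open>exp (- t (S i - S (i - n)))\<close> have summable expectations, and almost surely \<open>S\<close> tends to
  \<open>\<infinity>\<close> in the future and to \<open>-\<infinity>\<close> in the past.

  A vertex \<open>i\<close> is an ancestor of \<open>j < i\<close> iff \<open>S i \<ge> S l\<close> for all \<open>j \<le> l < i\<close>. Hence a running
  maximum of \<open>S\<close> is an ancestor of every earlier vertex. Running maxima occur arbitrarily late,
  which gives connectedness, and arbitrarily early, so they form a bi-infinite path, the
  spine. Every foil meets the spine in exactly one vertex. Let every vertex send unit mass to
  the spine vertex of its foil. By mass transport a vertex receives mass 1 in expectation,
  hence almost surely only finitely many vertices share a foil with a given spine vertex.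

  Mass transport holds on the integers for every translation covariant function because the
  increments are stationary, and unimodularity of the component is an instance of it.
\<close>


subsection \<open>The record map\<close>

text \<open>The two-sided walk \<open>S\<close> of the overview, normalised to vanish at 0. The sign
  on the negative side makes every block sum a height difference.\<close>

definition height :: "(int \<Rightarrow> int) \<Rightarrow> int \<Rightarrow> int" where
  "height x n = (if 0 \<le> n then sum x {0..<n} else - sum x {n..<0})"

lemma sum_concat_int:
  fixes x :: "int \<Rightarrow> int"
  assumes "i \<le> j" "j \<le> k"
  shows "sum x {i..<j} + sum x {j..<k} = sum x {i..<k}"
proof -
  have "{i..<k} = {i..<j} \<union> {j..<k}" using assms by auto
  then show ?thesis by (simp add: sum.union_disjoint ivl_disj_int)
qed

lemma sum_eq_height_diff:
  assumes "i \<le> j"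
  shows "sum x {i..<j} = height x j - height x i"
  using assms sum_concat_int[of 0 i j x] sum_concat_int[of i 0 j x] sum_concat_int[of i j 0 x]
  by (auto simp: height_def)

text \<open>First-passage form of the record map, free of \<open>Inf\<close>: covariance and
  measurability are both read off from it. The second disjunct is the default value at a vertex
  without a parent.\<close>

lemma record_map_eq_iff:
  "record_map x i = j \<longleftrightarrow>
     (i < j \<and> 0 \<le> sum x {i..<j} \<and> (\<forall>l. i < l \<and> l < j \<longrightarrow> sum x {i..<l} < 0)) \<or>
     (j = i \<and> (\<forall>l>i. sum x {i..<l} < 0))"
proof (cases "\<exists>j>i. 0 \<le> sum x {i..<j}")
  case True
  let ?A = "{j. i < j \<and> 0 \<le> sum x {i..<j}}"
  have below: "bdd_below ?A" by (rule bdd_belowI[of _ i]) auto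
  have nonempty: "?A \<noteq> {}" using True by auto
  have Inf_mem: "Inf ?A \<in> ?A"
  proof -
    \<comment> \<open>The infimum is attained because an integer in
      \<open>[Inf ?A, Inf ?A + 1)\<close> equals \<open>Inf ?A\<close>.\<close>
    obtain a where a: "a \<in> ?A" "a < Inf ?A + 1"
      using cInf_lessD[OF nonempty, of "Inf ?A + 1"] by auto
    moreover have "Inf ?A \<le> a" by (rule cInf_lower[OF a(1) below])
    ultimately have "a = Inf ?A" by simp
    with a(1) show ?thesis by metis
  qed
  have Inf_le: "Inf ?A \<le> l" if "l \<in> ?A" for l by (rule cInf_lower[OF that below])
  have "record_map x i = Inf ?A" using True by (simp add: record_map_def)
  moreover have "Inf ?A = j \<longleftrightarrow> j \<in> ?A \<and> (\<forall>l. i < l \<and> l < j \<longrightarrow> sum x {i..<l} < 0)"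
  proof
    assume "Inf ?A = j"
    with Inf_mem Inf_le show "j \<in> ?A \<and> (\<forall>l. i < l \<and> l < j \<longrightarrow> sum x {i..<l} < 0)"
      by (metis (mono_tags, lifting) linorder_not_le mem_Collect_eq)
  next
    assume j: "j \<in> ?A \<and> (\<forall>l. i < l \<and> l < j \<longrightarrow> sum x {i..<l} < 0)"
    with Inf_le have "Inf ?A \<le> j" by blast
    moreover have "\<not> Inf ?A < j"
      using j Inf_mem by (metis (mono_tags, lifting) linorder_not_le mem_Collect_eq)
    ultimately show "Inf ?A = j" by simp
  qed
  ultimately show ?thesis using True by (auto simp: not_less)
next
  case False
  then show ?thesis by (auto simp: record_map_def not_le)
qed

section \<open>Translations, running maxima and spine points\<close>

definition shift_seq :: "int \<Rightarrow> (int \<Rightarrow> 'a) \<Rightarrow> int \<Rightarrow> 'a" where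
  "shift_seq k x n = x (n + k)"

lemma shift_seq_shift_seq [simp]: "shift_seq k (shift_seq l x) = shift_seq (k + l) x"
  by (simp add: shift_seq_def fun_eq_iff add.assoc)

lemma shift_seq_0 [simp]: "shift_seq 0 x = x"
  by (simp add: shift_seq_def fun_eq_iff)

lemma sum_shift: "sum (shift_seq k x) {i..<j} = sum x {i + k..<j + k}"
  by (rule sum.reindex_bij_witness[of _ "\<lambda>n. n - k" "\<lambda>n. n + k"]) (auto simp: shift_seq_def)

lemma record_map_shift: "record_map (shift_seq k x) i = record_map x (i + k) - k"
proof -
  define j where "j = record_map x (i + k)"
  have j: "(i + k < j \<and> 0 \<le> sum x {i + k..<j} \<and>
        (\<forall>l. i + k < l \<and> l < j \<longrightarrow> sum x {i + k..<l} < 0)) \<or>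
      (j = i + k \<and> (\<forall>l>i + k. sum x {i + k..<l} < 0))"
    using record_map_eq_iff[of x "i + k" j] by (auto simp: j_def)
  have "record_map (shift_seq k x) i = j - k"
    unfolding record_map_eq_iff sum_shift using j by auto
  then show ?thesis by (simp add: j_def)
qed

lemma record_map_funpow_shift:
  "(record_map (shift_seq k x) ^^ n) i = (record_map x ^^ n) (i + k) - k"
  by (induction n) (simp_all add: record_map_shift)

text \<open>Weak maximum of the walk over its past. Block sums, unlike \<open>height\<close>, do not
  depend on an origin, so covariance under shifts is immediate.\<close>

definition running_max :: "(int \<Rightarrow> int) \<Rightarrow> int \<Rightarrow> bool" where
  "running_max x v \<longleftrightarrow> (\<forall>l<v. 0 \<le> sum x {l..<v})"

lemma running_max_shift: "running_max (shift_seq k x) v \<longleftrightarrow> running_max x (v + k)"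
proof
  assume *: "running_max (shift_seq k x) v"
  have "0 \<le> sum x {l..<v + k}" if "l < v + k" for l
    using *[unfolded running_max_def, rule_format, of "l - k"] that by (simp add: sum_shift)
  then show "running_max x (v + k)" by (simp add: running_max_def)
qed (auto simp: running_max_def sum_shift)

text \<open>The relation between a vertex and the spine vertex of its foil; it is the transport that
  later proves foils finite.\<close>

definition spine_point :: "(int \<Rightarrow> int) \<Rightarrow> int \<Rightarrow> int \<Rightarrow> bool" where
  "spine_point x u v \<longleftrightarrow>
     running_max x v \<and> (\<exists>n. (record_map x ^^ n) u = (record_map x ^^ n) v)"

lemma spine_point_shift: "spine_point (shift_seq k x) u v \<longleftrightarrow> spine_point x (u + k) (v + k)"
  by (simp add: spine_point_def running_max_shift record_map_funpow_shift)

section \<open>Deterministic study of the spine\<close>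

text \<open>These two properties of a path with positive drift carry the deterministic part:
  \<open>up\<close> gives every vertex a parent, and \<open>bounded_past\<close> bounds the walk
  above on each past half-line.\<close>

locale record_walk =
  fixes x :: "int \<Rightarrow> int"
  assumes up: "\<exists>j>i. 0 \<le> sum x {i..<j}"
    and bounded_past: "\<exists>K. \<forall>l\<le>n. K \<le> sum x {l..<n}"
begin

abbreviation "R \<equiv> record_map x"
abbreviation "S \<equiv> height x"

lemma R_record: "i < R i" "S i \<le> S (R i)" "i < l \<Longrightarrow> l < R i \<Longrightarrow> S l < S i"
  using record_map_eq_iff[of x i "R i"] up[of i]
  by (auto simp: sum_eq_height_diff not_less dest!: spec)

lemma R_le: "i < j \<Longrightarrow> S i \<le> S j \<Longrightarrow> R i \<le> j"
  using R_record(3)[of i j] by force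

lemma running_max_iff: "running_max x v \<longleftrightarrow> (\<forall>l\<le>v. S l \<le> S v)"
  by (force simp: running_max_def sum_eq_height_diff le_less)

text \<open>The ancestral line of \<open>u\<close> cannot jump over \<open>v\<close>: a vertex
  before \<open>v\<close> is no higher than \<open>v\<close>, so its parent is at most
  \<open>v\<close>. Induction on the remaining distance.\<close>

lemma running_max_ancestor:
  assumes "running_max x v" "u \<le> v"
  shows "\<exists>n. (R ^^ n) u = v"
  using assms(2)
proof (induction "nat (v - u)" arbitrary: u rule: less_induct)
  case less
  show ?case
  proof (cases "u = v")
    case True
    then show ?thesis by (auto intro: exI[of _ 0])
  next
    case False
    with less.prems have "u < v" by simp
    then have "R u \<le> v" using assms(1) by (intro R_le) (auto simp: running_max_iff)
    with R_record(1)[of u] \<open>u < v\<close> less.hyps[of "R u"] obtain n where "(R ^^ n) (R u) = v" by auto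
    then show ?thesis by (intro exI[of _ "Suc n"]) (simp add: funpow_swap1)
  qed
qed

text \<open>Up to \<open>v\<close> the walk stays below \<open>S v\<close>, which is at most
  \<open>S (R v)\<close>; strictly between \<open>v\<close> and \<open>R v\<close> it is even lower
  than \<open>S v\<close>.\<close>

lemma running_max_R:
  assumes "running_max x v"
  shows "running_max x (R v)"
  unfolding running_max_iff
proof (intro allI impI)
  fix l assume "l \<le> R v"
  then consider "l \<le> v" | "v < l" "l < R v" | "l = R v" by linarith
  then show "S l \<le> S (R v)"
    using assms R_record[of v] R_record(3)[of v l]
    by cases (force simp: running_max_iff)+
qed

lemma running_max_funpow: "running_max x v \<Longrightarrow> running_max x ((R ^^ n) v)"
  by (induction n) (simp_all add: running_max_R)

lemma funpow_R_ge: "v + int n \<le> (R ^^ n) v"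
proof (induction n)
  case (Suc n)
  then show ?case using R_record(1)[of "(R ^^ n) v"] by simp
qed simp

lemma running_max_below: "\<exists>r\<le>n. running_max x r"
proof -
  obtain K where K: "\<And>l. l \<le> n \<Longrightarrow> K \<le> S n - S l"
    using bounded_past[of n] by (force simp: sum_eq_height_diff)
  \<comment> \<open>\<open>S n - K\<close> bounds the walk up to time \<open>n\<close>, so the gap
    to this bound is a natural number; its minimiser is a highest point.\<close>
  obtain r where r: "r \<le> n" "\<And>l. l \<le> n \<Longrightarrow> nat (S n - K - S r) \<le> nat (S n - K - S l)"
    using ex_has_least_nat[of "\<lambda>l. l \<le> n" n "\<lambda>l. nat (S n - K - S l)"] by auto
  have "S l \<le> S r" if "l \<le> n" for l
    using r(2)[OF that] K[OF that] K[OF r(1)] by simp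
  with r(1) show ?thesis by (auto simp: running_max_iff)
qed

lemma running_max_above: "\<exists>r\<ge>n. running_max x r"
proof -
  obtain r where r: "r \<le> n" "running_max x r" using running_max_below by blast
  have "n \<le> (R ^^ nat (n - r)) r" using funpow_R_ge[of r "nat (n - r)"] r(1) by simp
  with running_max_funpow[OF r(2)] show ?thesis by blast
qed

text \<open>The preimage is the last running maximum \<open>w\<close> before \<open>v\<close>:
  \<open>R w\<close> is a later running maximum and at most \<open>v\<close>, hence equal to
  \<open>v\<close>. So the spine extends backwards without end.\<close>

lemma running_max_preimage:
  assumes "running_max x v"
  shows "\<exists>w. running_max x w \<and> R w = v"
proof -
  let ?A = "{w. w < v \<and> running_max x w}"
  obtain w0 where "w0 \<in> ?A" using running_max_below[of "v - 1"] by auto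
  then obtain w where w: "w \<in> ?A" "\<And>u. u \<in> ?A \<Longrightarrow> nat (v - w) \<le> nat (v - u)"
    using ex_has_least_nat[of "\<lambda>u. u \<in> ?A" w0 "\<lambda>u. nat (v - u)"] by blast
  have "R w \<le> v" using w(1) assms by (intro R_le) (auto simp: running_max_iff)
  moreover have "\<not> R w < v"
    using w(2)[of "R w"] w(1) running_max_R[of w] R_record(1)[of w] by auto
  ultimately show ?thesis using w(1) by auto
qed

lemma running_max_funpow_preimage:
  "running_max x v \<Longrightarrow> \<exists>w. running_max x w \<and> (R ^^ n) w = v"
proof (induction n arbitrary: v)
  case (Suc n)
  then obtain w where "running_max x w" "R w = v" using running_max_preimage by blast
  moreover obtain w' where "running_max x w'" "(R ^^ n) w' = w"
    using Suc.IH[OF \<open>running_max x w\<close>] by blast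
  ultimately show ?case by auto
qed auto

text \<open>Climb \<open>n\<close> generations from \<open>u\<close> to the spine, then go back
  \<open>n\<close> generations along the spine.\<close>

lemma ex_spine_point: "\<exists>v. spine_point x u v"
proof -
  obtain r where r: "u \<le> r" "running_max x r" using running_max_above by blast
  then obtain n where "(R ^^ n) u = r" using running_max_ancestor by blast
  moreover obtain w where "running_max x w" "(R ^^ n) w = r"
    using running_max_funpow_preimage[OF r(2)] by blast
  ultimately have "spine_point x u w" by (auto simp: spine_point_def intro: exI[of _ n])
  then show ?thesis ..
qed

lemma funpow_eq_mono:
  assumes "(R ^^ n) u = (R ^^ n) v" "n \<le> m"
  shows "(R ^^ m) u = (R ^^ m) v"
proof -
  have "R ^^ m = (R ^^ (m - n)) \<circ> (R ^^ n)" using assms(2) by (simp flip: funpow_add)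
  with assms(1) show ?thesis by simp
qed

text \<open>Of two spine vertices in one foil, the later is an ancestor of the earlier,
  \<open>d > 0\<close> steps away. Their common \<open>k\<close>-th ancestor would then be its own
  \<open>d\<close>-th ancestor, although \<open>R\<close> strictly increases.\<close>

lemma spine_point_unique:
  assumes "spine_point x u v" "spine_point x u w"
  shows "v = w"
proof -
  have "\<not> v < w" if "spine_point x u v" "spine_point x u w" for v w
  proof
    assume "v < w"
    obtain n m where nm: "(R ^^ n) u = (R ^^ n) v" "(R ^^ m) u = (R ^^ m) w"
      using \<open>spine_point x u v\<close> \<open>spine_point x u w\<close> by (auto simp: spine_point_def)
    define k where "k = max n m"
    have eq: "(R ^^ k) v = (R ^^ k) w"
      using funpow_eq_mono[OF nm(1), of k] funpow_eq_mono[OF nm(2), of k] by (simp add: k_def)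
    obtain d where d: "(R ^^ d) v = w"
      using running_max_ancestor[of w v] \<open>v < w\<close> \<open>spine_point x u w\<close>
      by (auto simp: spine_point_def)
    with \<open>v < w\<close> have "d > 0" by (cases d) auto
    have "(R ^^ k) w = (R ^^ d) ((R ^^ k) v)"
      unfolding d[symmetric] by (metis add.commute comp_apply funpow_add)
    then have "(R ^^ d) ((R ^^ k) v) = (R ^^ k) v" using eq by metis
    with funpow_R_ge[of "(R ^^ k) v" d] \<open>d > 0\<close> show False by linarith
  qed
  with assms show ?thesis by (meson linorder_neqE)
qed

text \<open>A running maximum \<open>r < i\<close> is a barrier: arcs from below \<open>r\<close>
  end at \<open>r\<close> or earlier, so all children of \<open>i\<close> lie between
  \<open>r\<close> and \<open>i\<close>. This gives local finiteness.\<close>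

lemma finite_R_fiber: "finite {j. R j = i}"
proof -
  obtain r where r: "r \<le> i - 1" "running_max x r" using running_max_below by blast
  have "{j. R j = i} \<subseteq> {r..i}"
  proof
    fix j assume "j \<in> {j. R j = i}"
    then have "R j = i" by simp
    moreover have "R j \<le> r" if "j < r"
      using that r(2) by (intro R_le) (auto simp: running_max_iff)
    ultimately show "j \<in> {r..i}" using r(1) R_record(1)[of j] by force
  qed
  then show ?thesis by (rule finite_subset) simp
qed

end

subsection \<open>The record graph\<close>

text \<open>Undirected adjacency as a plain relation, so that reachability becomes a reflexive
  transitive closure. The condition \<open>u \<noteq> v\<close> discards the default value of
  \<open>record_map\<close>.\<close>

definition record_edges :: "(int \<Rightarrow> int) \<Rightarrow> (int \<times> int) set" where
  "record_edges x = {(u, v). u \<noteq> v \<and> (record_map x u = v \<or> record_map x v = u)}"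

lemma wf_record_graph: "wf_digraph (record_graph x)"
  by unfold_locales (auto simp: record_graph_def)

lemma record_graph_simps [simp]:
  "verts (record_graph x) = UNIV"
  "arcs (record_graph x) = {(i, record_map x i) | i. record_map x i \<noteq> i}"
  "tail (record_graph x) = fst" "head (record_graph x) = snd"
  "arcs_ends (record_graph x) = {(i, record_map x i) | i. record_map x i \<noteq> i}"
  by (auto simp: record_graph_def)

lemma parcs_mk_symmetric_record_graph: "parcs (mk_symmetric (record_graph x)) = record_edges x"
  by (auto simp: parcs_mk_symmetric record_edges_def) metis+

lemma reachable_record_graph:
  "reachable (mk_symmetric (record_graph x)) u v \<longleftrightarrow> (u, v) \<in> (record_edges x)\<^sup>*"
proof -
  interpret pair_wf_digraph "mk_symmetric (record_graph x)"
    by (rule wf_digraph.wellformed_mk_symmetric[OF wf_record_graph])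
  show ?thesis
    by (subst reachable_conv') (simp_all add: parcs_mk_symmetric_record_graph)
qed

lemma component_simps [simp]:
  "verts (component_of (record_graph x) u) = {v. (u, v) \<in> (record_edges x)\<^sup>*}"
  "arcs (component_of (record_graph x) u) =
     {(i, record_map x i) | i. record_map x i \<noteq> i \<and> (u, i) \<in> (record_edges x)\<^sup>*}"
  "tail (component_of (record_graph x) u) = fst" "head (component_of (record_graph x) u) = snd"
proof -
  \<comment> \<open>A component is closed under parents, so the requirement that the head of an arc
    lie in the induced subgraph follows from that on the tail.\<close>
  have "(u, record_map x i) \<in> (record_edges x)\<^sup>*"
    if "(u, i) \<in> (record_edges x)\<^sup>*" "record_map x i \<noteq> i" for i
    using that by (auto simp: record_edges_def intro: rtrancl_into_rtrancl)
  then show "arcs (component_of (record_graph x) u) =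
     {(i, record_map x i) | i. record_map x i \<noteq> i \<and> (u, i) \<in> (record_edges x)\<^sup>*}"
    by (auto simp: component_of_def reachable_record_graph)
qed (auto simp: component_of_def reachable_record_graph)

lemma arcs_ends_component:
  "(i, j) \<in> arcs_ends (component_of (record_graph x) u) \<longleftrightarrow>
     record_map x i = j \<and> i \<noteq> j \<and> (u, i) \<in> (record_edges x)\<^sup>*"
  by (auto simp: arcs_ends_conv image_iff)

lemma wf_component: "wf_digraph (component_of (record_graph x) u)"
  by unfold_locales
    (auto simp: record_edges_def intro: rtrancl_into_rtrancl)

lemma sym_record_edges: "sym ((record_edges x)\<^sup>*)"
  by (intro sym_rtrancl symI) (auto simp: record_edges_def)

lemma component_eq:
  assumes "(u, v) \<in> (record_edges x)\<^sup>*"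
  shows "component_of (record_graph x) v = component_of (record_graph x) u"
proof -
  have "(v, u) \<in> (record_edges x)\<^sup>*" using sym_record_edges assms by (rule symD)
  with assms have "(v, w) \<in> (record_edges x)\<^sup>* \<longleftrightarrow> (u, w) \<in> (record_edges x)\<^sup>*" for w
    by (meson rtrancl_trans)
  then show ?thesis by (intro pre_digraph.equality) simp_all
qed

section \<open>Translation covariance of components\<close>

lemma record_edges_shift: "(u, v) \<in> record_edges (shift_seq k x) \<longleftrightarrow> (u + k, v + k) \<in> record_edges x"
  by (auto simp: record_edges_def record_map_shift)

lemma record_edges_rtrancl_shift:
  "(u, v) \<in> (record_edges (shift_seq k x))\<^sup>* \<longleftrightarrow> (u + k, v + k) \<in> (record_edges x)\<^sup>*"
proof
  have *: "(u + k, v + k) \<in> (record_edges x)\<^sup>*" if "(u, v) \<in> (record_edges (shift_seq k x))\<^sup>*"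
    for u v k and x
    using that
    by (induction rule: rtrancl_induct) (auto simp: record_edges_shift intro: rtrancl_into_rtrancl)
  show "(u + k, v + k) \<in> (record_edges x)\<^sup>*" if "(u, v) \<in> (record_edges (shift_seq k x))\<^sup>*"
    by (rule *[OF that])
  show "(u, v) \<in> (record_edges (shift_seq k x))\<^sup>*" if "(u + k, v + k) \<in> (record_edges x)\<^sup>*"
    \<comment> \<open>The converse is the first direction for the inverse shift.\<close>
    using *[of "u + k" "v + k" "- k" "shift_seq k x"] that by simp
qed

text \<open>Arcs are pairs of vertices, so both coordinates move and the projections stay tail and
  head. The image is then literally a component of another record graph.\<close>

definition translation :: "int \<Rightarrow> (int, int \<times> int, int, int \<times> int) digraph_isomorphism" where
  "translation k = \<lparr>iso_verts = \<lambda>v. v + k, iso_arcs = map_prod (\<lambda>v. v + k) (\<lambda>v. v + k),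
     iso_head = snd, iso_tail = fst\<rparr>"

lemma translation_isomorphism:
  "pre_digraph.digraph_isomorphism (component_of (record_graph x) u) (translation k)"
  unfolding pre_digraph.digraph_isomorphism_def
  using wf_component by (auto simp: translation_def inj_on_def)

text \<open>Turns invariance of test functions under isomorphism into covariance under shifts of the
  increments.\<close>

lemma component_shift:
  "app_iso (translation k) (component_of (record_graph (shift_seq k x)) u) =
     component_of (record_graph x) (u + k)"
proof (rule pre_digraph.equality)
  let ?G = "component_of (record_graph (shift_seq k x)) u"
  let ?H = "component_of (record_graph x) (u + k)"
  have "v \<in> (\<lambda>v. v + k) ` verts ?G \<longleftrightarrow> v - k \<in> verts ?G" for v
    by (auto simp del: component_simps intro: image_eqI[of _ _ "v - k"])
  then show "verts (app_iso (translation k) ?G) = verts ?H"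
    by (auto simp: translation_def record_edges_rtrancl_shift)
  have "e \<in> map_prod (\<lambda>v. v + k) (\<lambda>v. v + k) ` arcs ?G \<longleftrightarrow>
      map_prod (\<lambda>v. v - k) (\<lambda>v. v - k) e \<in> arcs ?G" for e
    by (cases e) (auto simp del: component_simps intro: image_eqI[of _ _ "map_prod (\<lambda>v. v - k) (\<lambda>v. v - k) e"])
  then show "arcs (app_iso (translation k) ?G) = arcs ?H"
    by (auto simp: translation_def record_map_shift record_edges_rtrancl_shift)
qed (simp_all add: translation_def)

section \<open>Connectedness and tree structure\<close>

lemma pcas_nth:
  "pcas u p v \<Longrightarrow> Suc k < length p \<Longrightarrow> fst (p ! Suc k) = snd (p ! k)"
proof (induction p arbitrary: u k)
  case (Cons e p)
  then show ?case by (cases k; cases p) auto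
qed simp

lemma pcas_ends: "pcas u p v \<Longrightarrow> p \<noteq> [] \<Longrightarrow> fst (p ! 0) = u \<and> snd (p ! (length p - 1)) = v"
proof (induction p arbitrary: u)
  case (Cons e p)
  then show ?case by (cases p) auto
qed simp

lemma tl_pawalk_verts: "pcas u p v \<Longrightarrow> tl (pawalk_verts u p) = map snd p"
proof (induction p arbitrary: u)
  case (Cons e p)
  then show ?case by (cases p) auto
qed simp

context record_walk
begin

text \<open>A running maximum beyond both vertices is a common ancestor.\<close>

lemma connected_edges: "(u, v) \<in> (record_edges x)\<^sup>*"
proof -
  have path: "(w, (R ^^ n) w) \<in> (record_edges x)\<^sup>*" for w n
  proof (induction n)
    case (Suc n)
    then show ?case using R_record(1)[of "(R ^^ n) w"]
      by (auto simp: record_edges_def intro: rtrancl_into_rtrancl)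
  qed simp
  obtain r where r: "max u v \<le> r" "running_max x r" using running_max_above by blast
  obtain n m where "(R ^^ n) u = r" "(R ^^ m) v = r"
    using running_max_ancestor[OF r(2), of u] running_max_ancestor[OF r(2), of v] r(1) by auto
  with path[of u n] path[of v m] show ?thesis
    using sym_record_edges by (metis rtrancl_trans symD)
qed

lemma connected_record_graph: "Digraph_Component.connected (record_graph x)"
  by (auto simp: connected_def strongly_connected_def reachable_record_graph connected_edges)

lemma component_eq_record_graph: "component_of (record_graph x) u = record_graph x"
  by (intro pre_digraph.equality) (auto simp: connected_edges)

(* The least vertex of an undirected cycle would need two different parents. *)
lemma no_cycle:
  assumes "pre_digraph.cycle (with_proj (mk_symmetric (record_graph x))) p"
  shows "length p < 3"
proof (rule ccontr)
  assume "\<not> length p < 3"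
  define n where "n = length p"
  have n: "3 \<le> n" using \<open>\<not> length p < 3\<close> by (simp add: n_def)
  obtain u where u: "set p \<subseteq> record_edges x" "pcas u p u" "distinct (tl (pawalk_verts u p))"
    using assms
    by (auto simp: pre_digraph.cycle_def pre_digraph.awalk_def cas_with_proj_eq
        awalk_verts_with_proj_eq parcs_mk_symmetric_record_graph)
  define w where "w k = snd (p ! k)" for k
  have w_inj: "w k = w l \<longleftrightarrow> k = l" if "k < n" "l < n" for k l
    using u(3) that unfolding tl_pawalk_verts[OF u(2)]
    by (auto simp: w_def n_def distinct_conv_nth)
  \<comment> \<open>Cyclic neighbours of an index: arc \<open>k\<close> runs from
    \<open>w (prev k)\<close> to \<open>w k\<close>.\<close>
  define prev where "prev k = (if k = 0 then n - 1 else k - 1)" for k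
  define nxt where "nxt k = (if k = n - 1 then 0 else k + 1)" for k
  \<comment> \<open>In a closed walk of length two both neighbours would coincide; length three
    separates them.\<close>
  have bounds: "prev k < n" "nxt k < n" "prev k \<noteq> nxt k" if "k < n" for k
    using that n by (auto simp: prev_def nxt_def)
  have fst_p: "fst (p ! k) = w (prev k)" if "k < n" for k
    using pcas_ends[OF u(2)] pcas_nth[OF u(2), of "k - 1"] that n
    by (cases k) (auto simp: w_def prev_def n_def)
  have prev_nxt: "prev (nxt k) = k" if "k < n" for k
    using that n by (auto simp: prev_def nxt_def)
  have edge: "(w (prev k), w k) \<in> record_edges x" if "k < n" for k
    using u(1) that fst_p[OF that] unfolding w_def n_def
    by (metis nth_mem prod.collapse subsetD)
  have "finite (w ` {..<n})" "w ` {..<n} \<noteq> {}" using n by (auto simp: lessThan_empty_iff)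
  from Min_in[OF this] obtain k where k: "k < n" "w k = Min (w ` {..<n})" by auto
  have min: "w k \<le> w l" if "l < n" for l using that k(2) by simp
  have parent: "R (w k) = w l" if "(w k, w l) \<in> record_edges x" "l < n" for l
    using that min[OF that(2)] R_record(1)[of "w l"] by (auto simp: record_edges_def)
  have "(w k, w (nxt k)) \<in> record_edges x"
    using edge[of "nxt k"] bounds k(1) by (simp add: prev_nxt)
  moreover have "(w k, w (prev k)) \<in> record_edges x"
    using edge[OF k(1)] by (auto simp: record_edges_def)
  ultimately have "w (prev k) = w (nxt k)" using parent bounds k(1) by metis
  with w_inj bounds k(1) show False by blast
qed

lemma family_tree_record_graph: "family_tree (record_graph x)"
proof -
  have "nomulti_digraph (record_graph x)"
    by unfold_locales (auto simp: arc_to_ends_def)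
  moreover have "loopfree_digraph (record_graph x)"
    by unfold_locales auto
  moreover have "asym (arcs_ends (record_graph x))"
  proof (rule asymI)
    fix i j assume "(i, j) \<in> arcs_ends (record_graph x)"
    then have "i < j" using R_record(1)[of i] by auto
    then show "(j, i) \<notin> arcs_ends (record_graph x)" using R_record(1)[of j] by auto
  qed
  moreover have "locally_finite (record_graph x)"
    unfolding locally_finite_def
  proof (intro ballI conjI)
    fix v
    have "in_arcs (record_graph x) v \<subseteq> (\<lambda>j. (j, v)) ` {j. R j = v}" by auto
    then show "finite (in_arcs (record_graph x) v)"
      by (rule finite_subset) (simp add: finite_R_fiber)
    have "out_arcs (record_graph x) v \<subseteq> {(v, R v)}" by auto
    then show "finite (out_arcs (record_graph x) v)" by (rule finite_subset) simp
  qed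
  moreover have "out_degree (record_graph x) v \<le> 1" for v
  proof -
    have "out_arcs (record_graph x) v \<subseteq> {(v, R v)}" by auto
    from card_mono[OF _ this] show ?thesis by (simp add: out_degree_def)
  qed
  ultimately show ?thesis
    using connected_record_graph no_cycle
    by (auto simp: family_tree_def directed_tree_def not_le)
qed

lemma parent_record_graph: "parent (record_graph x) = R"
  using R_record(1) by (fastforce simp: parent_def fun_eq_iff)

text \<open>All vertices of a foil share one spine point, so a foil lies inside a set that is finite
  by assumption.\<close>

lemma class_I_F_record_graph:
  assumes "\<And>v. finite {u. spine_point x u v}"
  shows "class_I_F (record_graph x)"
proof -
  have "finite (foil (record_graph x) u)" for u
  proof -
    obtain v where v: "spine_point x u v" using ex_spine_point by blast
    have "spine_point x w v" if w: "w \<in> foil (record_graph x) u" for w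
    proof -
      obtain n m where nm: "(R ^^ n) w = (R ^^ n) u" "(R ^^ m) u = (R ^^ m) v"
        using w v by (auto simp: foil_def parent_record_graph spine_point_def)
      have "(R ^^ max n m) w = (R ^^ max n m) v"
        using funpow_eq_mono[OF nm(1), of "max n m"] funpow_eq_mono[OF nm(2), of "max n m"] by simp
      with v show ?thesis by (auto simp: spine_point_def)
    qed
    then have "foil (record_graph x) u \<subseteq> {w. spine_point x w v}" by auto
    then show ?thesis using assms by (rule finite_subset)
  qed
  then show ?thesis by (simp add: class_I_F_def family_tree_record_graph infinite_UNIV_int)
qed

end

subsection \<open>Measurability\<close>

abbreviation increment_space :: "(int \<Rightarrow> int) measure" where
  "increment_space \<equiv> Pi\<^sub>M UNIV (\<lambda>_. count_space UNIV)"

lemma measurable_coordinate [measurable]: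
  "(\<lambda>x. x i) \<in> increment_space \<rightarrow>\<^sub>M count_space UNIV"
  by (rule measurable_component_singleton) simp

lemma measurable_coordinate_sum [measurable]:
  assumes "finite A"
  shows "(\<lambda>x. sum x A) \<in> increment_space \<rightarrow>\<^sub>M count_space UNIV"
  using assms
proof (induction A rule: finite_induct)
  case (insert a A)
  have "(\<lambda>x. x a + sum x A) \<in> increment_space \<rightarrow>\<^sub>M count_space UNIV"
    by (rule measurable_compose_countable[of "\<lambda>s x. x a + s", OF _ insert.IH])
      (rule measurable_compose[OF measurable_coordinate], simp)
  then show ?case using insert.hyps by simp
qed simp

text \<open>By the first-passage form, each level set is a countable combination of events about
  finite sums.\<close>

lemma measurable_record_map [measurable]:
  "(\<lambda>x. record_map x i) \<in> increment_space \<rightarrow>\<^sub>M count_space UNIV"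
proof -
  have "Measurable.pred increment_space (\<lambda>x. P (sum x {a..<b}))" for P and a b :: int
    by (rule measurable_compose[OF measurable_coordinate_sum]) simp_all
  note [measurable] = this
  have [measurable]: "Measurable.pred increment_space (\<lambda>x. record_map x i = j)" for j
    unfolding record_map_eq_iff by measurable
  have "{x \<in> space increment_space. record_map x i = j} \<in> sets increment_space" for j
    by measurable
  moreover have "(\<lambda>x. record_map x i) -` {j} \<inter> space increment_space =
      {x \<in> space increment_space. record_map x i = j}" for j
    by auto
  ultimately show ?thesis by (simp add: measurable_count_space_eq2_countable)
qed

lemma measurable_record_map_funpow [measurable]:
  "(\<lambda>x. (record_map x ^^ n) i) \<in> increment_space \<rightarrow>\<^sub>M count_space UNIV"
proof (induction n)
  case (Suc n)
  have "(\<lambda>x. record_map x ((record_map x ^^ n) i)) \<in> increment_space \<rightarrow>\<^sub>M count_space UNIV"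
    by (rule measurable_compose_countable[of "\<lambda>j x. record_map x j", OF measurable_record_map Suc])
  then show ?case by simp
qed simp

lemma measurable_spine_point [measurable]:
  "Measurable.pred increment_space (\<lambda>x. spine_point x u v)"
proof -
  have "Measurable.pred increment_space (\<lambda>x. 0 \<le> sum x {a..<b})" for a b :: int
    by (rule measurable_compose[OF measurable_coordinate_sum]) simp_all
  note [measurable] = this
  \<comment> \<open>Naming the common value \<open>j\<close> writes the coincidence of two random
    vertices as a countable union of measurable events.\<close>
  have "Measurable.pred increment_space
      (\<lambda>x. \<exists>j. (record_map x ^^ n) u = j \<and> (record_map x ^^ n) v = j)" for n
    by measurable
  then have [measurable]: "Measurable.pred increment_space
      (\<lambda>x. (record_map x ^^ n) u = (record_map x ^^ n) v)" for n
    by simp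
  show ?thesis unfolding spine_point_def running_max_def by measurable
qed

text \<open>Reachability is a countable union over path lengths and, by induction on the length,
  over the last intermediate vertex.\<close>

lemma measurable_record_edges_rtrancl [measurable]:
  "Measurable.pred increment_space (\<lambda>x. (u, v) \<in> (record_edges x)\<^sup>*)"
proof -
  have "Measurable.pred increment_space (\<lambda>x. (u, v) \<in> record_edges x ^^ n)" for n
  proof (induction n arbitrary: v)
    case (Suc n)
    note [measurable] = Suc
    have "Measurable.pred increment_space
      (\<lambda>x. \<exists>w. (u, w) \<in> record_edges x ^^ n \<and> w \<noteq> v \<and> (record_map x w = v \<or> record_map x v = w))"
      by measurable
    moreover have "(u, v) \<in> record_edges x ^^ Suc n \<longleftrightarrow>
      (\<exists>w. (u, w) \<in> record_edges x ^^ n \<and> w \<noteq> v \<and> (record_map x w = v \<or> record_map x v = w))" for x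
      by (auto simp: record_edges_def)
    ultimately show ?case by simp
  qed simp
  note [measurable] = this
  show ?thesis unfolding rtrancl_power by measurable
qed

lemma measurable_component [measurable]:
  "(\<lambda>x. component_of (record_graph x) u) \<in> increment_space \<rightarrow>\<^sub>M graph_space"
  unfolding graph_space_def
proof (rule measurable_measure_of)
  fix A :: "(int, int \<times> int) pre_digraph set"
  assume "A \<in> range (\<lambda>u. {G. u \<in> verts G}) \<union> range (\<lambda>(u, v). {G. u \<rightarrow>\<^bsub>G\<^esub> v})"
  then consider v where "A = {G. v \<in> verts G}" | v w where "A = {G. v \<rightarrow>\<^bsub>G\<^esub> w}" by auto
  then show "(\<lambda>x. component_of (record_graph x) u) -` A \<inter> space increment_space
      \<in> sets increment_space"
  proof cases
    case 1
    have "{x \<in> space increment_space. (u, v) \<in> (record_edges x)\<^sup>*} \<in> sets increment_space"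
      by measurable
    then show ?thesis by (simp add: 1 vimage_def Collect_conj_eq Int_commute)
  next
    case 2
    have "{x \<in> space increment_space. record_map x v = w \<and> v \<noteq> w \<and> (u, v) \<in> (record_edges x)\<^sup>*}
        \<in> sets increment_space"
      by measurable
    then show ?thesis
      by (simp add: 2 vimage_def arcs_ends_component Collect_conj_eq Int_commute)
  qed
qed auto

lemma measurable_shift [measurable]: "shift_seq k \<in> increment_space \<rightarrow>\<^sub>M increment_space"
proof -
  have "(\<lambda>x n. x (n + k)) \<in> increment_space \<rightarrow>\<^sub>M increment_space"
    by (rule measurable_PiM_single') auto
  then show ?thesis by (simp add: shift_seq_def[abs_def])
qed

text \<open>Makes the total mass received by a vertex measurable: a countable index gives joint
  measurability, and its counting measure is sigma-finite.\<close>

lemma borel_measurable_nn_integral_count_space: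
  fixes f :: "'a \<Rightarrow> 'b::countable \<Rightarrow> ennreal"
  assumes [measurable]: "\<And>u. (\<lambda>x. f x u) \<in> borel_measurable N"
  shows "(\<lambda>x. \<integral>\<^sup>+u. f x u \<partial>count_space UNIV) \<in> borel_measurable N"
proof (rule sigma_finite_measure.borel_measurable_nn_integral)
  have "(\<lambda>p. f (fst p) (snd p)) \<in> borel_measurable (N \<Otimes>\<^sub>M count_space UNIV)"
    by (rule measurable_compose_countable[of "\<lambda>u p. f (fst p) u"]) simp_all
  then show "case_prod f \<in> borel_measurable (N \<Otimes>\<^sub>M count_space UNIV)"
    by (simp add: case_prod_beta')
qed (rule sigma_finite_measure_count_space)

subsection \<open>Stationarity and mass transport\<close>

context skip_free_increments
begin

abbreviation increments :: "'w \<Rightarrow> int \<Rightarrow> int" where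
  "increments \<omega> \<equiv> \<lambda>n. X n \<omega>"

lemma X_measurable [measurable]: "X n \<in> M \<rightarrow>\<^sub>M count_space UNIV"
  using independent by (simp add: indep_vars_def)

lemma increments_measurable [measurable]: "increments \<in> M \<rightarrow>\<^sub>M increment_space"
  by (rule measurable_PiM_single') auto

lemma distr_increments:
  "distr M increment_space increments =
     Pi\<^sub>M UNIV (\<lambda>_. distr M (count_space UNIV) (X 0))"
proof -
  have "distr M increment_space (\<lambda>\<omega>. \<lambda>i\<in>UNIV. X i \<omega>) =
      Pi\<^sub>M UNIV (\<lambda>i. distr M (count_space UNIV) (X i))"
    using independent by (subst (asm) indep_vars_iff_distr_eq_PiM) auto
  also have "\<dots> = Pi\<^sub>M UNIV (\<lambda>_. distr M (count_space UNIV) (X 0))"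
    by (intro PiM_cong identically_distributed refl)
  finally show ?thesis by (simp only: restrict_UNIV)
qed

text \<open>Stationarity: a product of identical factors is invariant under injective
  reindexing.\<close>

lemma distr_shift:
  "distr (distr M increment_space increments) increment_space (shift_seq k) =
     distr M increment_space increments"
proof -
  let ?D = "distr M (count_space UNIV) (X 0)"
  \<comment> \<open>The product of the laws and \<open>increment_space\<close> are different
    measures on one sigma-algebra, so the target of the distribution may be exchanged.\<close>
  have sets: "sets (Pi\<^sub>M UNIV (\<lambda>_. ?D)) = sets increment_space"
    by (intro sets_PiM_cong) simp_all
  have "distr (Pi\<^sub>M UNIV (\<lambda>_. ?D)) (Pi\<^sub>M UNIV (\<lambda>_. ?D)) (\<lambda>x. \<lambda>n\<in>UNIV. x (n + k)) = Pi\<^sub>M UNIV (\<lambda>_. ?D)"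
    by (rule distr_PiM_reindex) (auto intro: prob_space_distr simp: inj_on_def)
  then have "distr (Pi\<^sub>M UNIV (\<lambda>_. ?D)) increment_space (\<lambda>x n. x (n + k)) = Pi\<^sub>M UNIV (\<lambda>_. ?D)"
    using distr_cong[OF refl sets, of "Pi\<^sub>M UNIV (\<lambda>_. ?D)" "\<lambda>x n. x (n + k)" "\<lambda>x n. x (n + k)"]
    by (simp only: restrict_UNIV)
  then show ?thesis by (simp add: distr_increments shift_seq_def[abs_def])
qed

lemma nn_integral_shift:
  assumes [measurable]: "f \<in> borel_measurable increment_space"
  shows "(\<integral>\<^sup>+\<omega>. f (shift_seq k (increments \<omega>)) \<partial>M) = (\<integral>\<^sup>+\<omega>. f (increments \<omega>) \<partial>M)"
proof -
  have "(\<integral>\<^sup>+\<omega>. f (shift_seq k (increments \<omega>)) \<partial>M) =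
      (\<integral>\<^sup>+x. f x \<partial>distr (distr M increment_space increments) increment_space (shift_seq k))"
    by (simp add: nn_integral_distr)
  also have "\<dots> = (\<integral>\<^sup>+\<omega>. f (increments \<omega>) \<partial>M)"
    by (simp add: distr_shift nn_integral_distr)
  finally show ?thesis .
qed

lemma AE_shift:
  assumes "AE \<omega> in M. P (increments \<omega>)"
    and [measurable]: "Measurable.pred increment_space P"
  shows "AE \<omega> in M. P (shift_seq k (increments \<omega>))"
proof -
  have "AE x in distr M increment_space increments. P x"
    using assms by (subst AE_distr_iff) auto
  then have "AE x in distr (distr M increment_space increments) increment_space (shift_seq k). P x"
    by (subst distr_shift)
  then have "AE x in distr M increment_space increments. P (shift_seq k x)"
    by (rule AE_distrD[rotated]) simp
  then show ?thesis by (rule AE_distrD[OF increments_measurable])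
qed

text \<open>Exchange sum and expectation, shift by \<open>- v\<close> so that mass sent from 0 to
  \<open>v\<close> becomes mass sent from \<open>- v\<close> to 0, and replace \<open>- v\<close> by
  \<open>v\<close> in the sum.\<close>

lemma mass_transport_increments:
  fixes f :: "(int \<Rightarrow> int) \<Rightarrow> int \<Rightarrow> int \<Rightarrow> ennreal"
  assumes [measurable]: "\<And>u v. (\<lambda>x. f x u v) \<in> borel_measurable increment_space"
    and covariant: "\<And>x k u v. f (shift_seq k x) u v = f x (u + k) (v + k)"
  shows "(\<integral>\<^sup>+\<omega>. \<integral>\<^sup>+v. f (increments \<omega>) 0 v \<partial>count_space UNIV \<partial>M) =
    (\<integral>\<^sup>+\<omega>. \<integral>\<^sup>+v. f (increments \<omega>) v 0 \<partial>count_space UNIV \<partial>M)"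
proof -
  have "(\<integral>\<^sup>+\<omega>. \<integral>\<^sup>+v. f (increments \<omega>) 0 v \<partial>count_space UNIV \<partial>M) =
      (\<integral>\<^sup>+v. \<integral>\<^sup>+\<omega>. f (increments \<omega>) 0 v \<partial>M \<partial>count_space UNIV)"
    by (rule nn_integral_count_space_nn_integral) simp_all
  also have "\<dots> = (\<integral>\<^sup>+v. \<integral>\<^sup>+\<omega>. f (increments \<omega>) (- v) 0 \<partial>M \<partial>count_space UNIV)"
  proof (rule nn_integral_cong)
    fix v :: int
    have "(\<integral>\<^sup>+\<omega>. f (increments \<omega>) 0 v \<partial>M) = (\<integral>\<^sup>+\<omega>. f (shift_seq (- v) (increments \<omega>)) 0 v \<partial>M)"
      by (rule nn_integral_shift[symmetric]) simp
    then show "(\<integral>\<^sup>+\<omega>. f (increments \<omega>) 0 v \<partial>M) = (\<integral>\<^sup>+\<omega>. f (increments \<omega>) (- v) 0 \<partial>M)"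
      by (simp add: covariant)
  qed
  also have "\<dots> = (\<integral>\<^sup>+v. \<integral>\<^sup>+\<omega>. f (increments \<omega>) v 0 \<partial>M \<partial>count_space UNIV)"
    by (rule nn_integral_bij_count_space) (rule bij_uminus)
  also have "\<dots> = (\<integral>\<^sup>+\<omega>. \<integral>\<^sup>+v. f (increments \<omega>) v 0 \<partial>count_space UNIV \<partial>M)"
    by (rule nn_integral_count_space_nn_integral[symmetric]) simp_all
  finally show ?thesis .
qed

lemma unimodular_component:
  "unimodular M (\<lambda>\<omega>. component_of (record_graph (increments \<omega>)) 0) 0"
  unfolding unimodular_def
proof (intro conjI allI impI ballI)
  show "(\<lambda>\<omega>. component_of (record_graph (increments \<omega>)) 0) \<in> M \<rightarrow>\<^sub>M graph_space"
    by (rule measurable_compose[OF increments_measurable measurable_component])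
  show "0 \<in> verts (component_of (record_graph (increments \<omega>)) 0)" for \<omega> by simp
  fix g :: "(int, int \<times> int) pre_digraph \<Rightarrow> int \<Rightarrow> int \<Rightarrow> ennreal"
  assume g: "mass_transport g"
  let ?C = "\<lambda>x u. component_of (record_graph x) u"
  have [measurable]: "(\<lambda>x. g (?C x w) u v) \<in> borel_measurable increment_space" for u v w
  proof (rule measurable_compose[OF measurable_component])
    show "(\<lambda>G. g G u v) \<in> borel_measurable graph_space"
      using g by (auto simp: mass_transport_def)
  qed
  \<comment> \<open>Extends the transport to all pairs of integers: it acts in the component of the
    sender and vanishes between different components.\<close>
  define f where "f x u v = g (?C x u) u v * indicator {x. (u, v) \<in> (record_edges x)\<^sup>*} x" for x u v
  have iso: "g (?C x (u + k)) (u + k) (v + k) = g (?C (shift_seq k x) u) u v"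
    if "(u, v) \<in> (record_edges (shift_seq k x))\<^sup>*" for x u v k
  proof -
    have "g (app_iso (translation k) (?C (shift_seq k x) u))
        (iso_verts (translation k) u) (iso_verts (translation k) v) = g (?C (shift_seq k x) u) u v"
      using g translation_isomorphism that by (auto simp: mass_transport_def)
    then show ?thesis unfolding component_shift by (simp add: translation_def)
  qed
  have covariant: "f (shift_seq k x) u v = f x (u + k) (v + k)" for x k u v
    using iso[of u v k x] by (auto simp: f_def record_edges_rtrancl_shift split: split_indicator)
  have [measurable]: "(\<lambda>x. f x u v) \<in> borel_measurable increment_space" for u v
    unfolding f_def by measurable
  have out: "(\<integral>\<^sup>+v. g (?C x 0) 0 v \<partial>count_space (verts (?C x 0))) =
      (\<integral>\<^sup>+v. f x 0 v \<partial>count_space UNIV)" for x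
    by (subst nn_integral_count_space_indicator)
      (auto intro!: nn_integral_cong simp: f_def indicator_def)
  have into: "(\<integral>\<^sup>+v. g (?C x 0) v 0 \<partial>count_space (verts (?C x 0))) =
      (\<integral>\<^sup>+v. f x v 0 \<partial>count_space UNIV)" for x
  proof -
    \<comment> \<open>The sender is now \<open>v\<close>, but \<open>v\<close> and 0 have the same
      component whenever the indicator is nonzero.\<close>
    have "g (?C x 0) v 0 * indicator {v. (0, v) \<in> (record_edges x)\<^sup>*} v = f x v 0" for v
      using component_eq[of 0 v x] sym_record_edges[of x]
      by (auto simp: f_def indicator_def dest: symD)
    then show ?thesis by (subst nn_integral_count_space_indicator) simp_all
  qed
  show "(\<integral>\<^sup>+\<omega>. \<integral>\<^sup>+v. g (?C (increments \<omega>) 0) 0 v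
        \<partial>count_space (verts (?C (increments \<omega>) 0)) \<partial>M) =
      (\<integral>\<^sup>+\<omega>. \<integral>\<^sup>+v. g (?C (increments \<omega>) 0) v 0
        \<partial>count_space (verts (?C (increments \<omega>) 0)) \<partial>M)"
    unfolding out into by (rule mass_transport_increments) (simp_all add: covariant)
qed

subsection \<open>Almost sure properties of the walk\<close>

text \<open>The derivative at \<open>t = 0\<close> of the expectation of
  \<open>1 - exp (- t X)\<close> is the mean, which is positive. Dominated convergence along
  difference quotients makes one of them positive in expectation, and its step size is
  \<open>t\<close>.\<close>

lemma exp_moment_less_1:
  assumes "0 < expectation (\<lambda>\<omega>. real_of_int (X 0 \<omega>))"
  obtains t where "0 < t" "(\<integral>\<^sup>+\<omega>. ennreal (exp (- t * real_of_int (X 0 \<omega>))) \<partial>M) < 1"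
proof -
  define s where "s k = inverse (real (Suc k))" for k
  have s: "0 < s k" "s k \<le> 1" for k by (simp_all add: s_def inverse_le_1_iff)
  have s_lim: "s \<longlonglongrightarrow> 0" unfolding s_def by (rule LIMSEQ_inverse_real_of_nat)
  define f where "f k \<omega> = (1 - exp (- s k * real_of_int (X 0 \<omega>))) / s k" for k \<omega>
  have lim: "(\<lambda>k. f k \<omega>) \<longlonglongrightarrow> real_of_int (X 0 \<omega>)" for \<omega>
  proof -
    let ?c = "real_of_int (X 0 \<omega>)"
    have "((\<lambda>h. 1 - exp (- h * ?c)) has_real_derivative ?c) (at 0)"
      by (auto intro!: derivative_eq_intros)
    from DERIV_D[OF this] have "((\<lambda>h. (1 - exp (- h * ?c)) / h) \<longlongrightarrow> ?c) (at 0)" by simp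
    then show ?thesis
      unfolding tendsto_at_iff_sequentially f_def
      using s(1) s_lim by (force simp: comp_def less_imp_neq[symmetric])
  qed
  \<comment> \<open>A bound uniform in \<open>k\<close>. For a nonnegative increment the quotient
    lies between 0 and the increment; the only negative value is \<open>- 1\<close>, where
    \<open>exp s - 1 \<le> 2 * s\<close> for \<open>s \<le> 1\<close> applies.\<close>
  have bound: "\<bar>f k \<omega>\<bar> \<le> \<bar>real_of_int (X 0 \<omega>)\<bar> + 2" if "- 1 \<le> X 0 \<omega>" for k \<omega>
  proof (cases "X 0 \<omega> = - 1")
    case True
    have "exp (s k) - 1 \<le> s k * (1 + s k)"
      using exp_bound[of "s k"] s[of k] by (simp add: algebra_simps power2_eq_square)
    also have "\<dots> \<le> s k * 2" using s[of k] by (intro mult_left_mono) simp_all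
    finally have "exp (s k) - 1 \<le> s k * 2" .
    moreover have "1 \<le> exp (s k)" using s(1)[of k] by simp
    ultimately show ?thesis using s(1)[of k] True by (simp add: f_def field_simps abs_if)
  next
    case False
    with that have c: "0 \<le> real_of_int (X 0 \<omega>)" by simp
    have "1 - exp (- s k * real_of_int (X 0 \<omega>)) \<le> s k * real_of_int (X 0 \<omega>)"
      using exp_ge_add_one_self[of "- s k * real_of_int (X 0 \<omega>)"] by simp
    moreover have "0 \<le> 1 - exp (- s k * real_of_int (X 0 \<omega>))"
      using s(1)[of k] c by simp
    ultimately show ?thesis using s(1)[of k] c by (simp add: f_def field_simps)
  qed
  have f_meas: "f k \<in> borel_measurable M" for k unfolding f_def by measurable
  have dom: "integrable M (\<lambda>\<omega>. \<bar>real_of_int (X 0 \<omega>)\<bar> + 2)" using finite_mean by simp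
  have AE_bound: "AE \<omega> in M. norm (f k \<omega>) \<le> \<bar>real_of_int (X 0 \<omega>)\<bar> + 2" for k
    using skip_free[of 0] by eventually_elim (use bound in auto)
  have "(\<lambda>k. expectation (f k)) \<longlonglongrightarrow> expectation (\<lambda>\<omega>. real_of_int (X 0 \<omega>))"
    by (rule integral_dominated_convergence[OF _ f_meas dom _ AE_bound]) (simp_all add: lim)
  from order_tendstoD(1)[OF this assms] obtain k where k: "0 < expectation (f k)"
    by (auto simp: eventually_sequentially)
  have int_f: "integrable M (f k)"
    by (rule Bochner_Integration.integrable_bound[OF dom f_meas]) (use AE_bound[of k] in auto)
  have exp_eq: "exp (- s k * real_of_int (X 0 \<omega>)) = 1 - s k * f k \<omega>" for \<omega>
    using s(1)[of k] by (simp add: f_def)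
  have int_exp: "integrable M (\<lambda>\<omega>. exp (- s k * real_of_int (X 0 \<omega>)))"
    unfolding exp_eq using int_f by simp
  have "(\<integral>\<^sup>+\<omega>. ennreal (exp (- s k * real_of_int (X 0 \<omega>))) \<partial>M) =
      ennreal (expectation (\<lambda>\<omega>. exp (- s k * real_of_int (X 0 \<omega>))))"
    by (rule nn_integral_eq_integral[OF int_exp]) simp
  also have "expectation (\<lambda>\<omega>. exp (- s k * real_of_int (X 0 \<omega>))) = 1 - s k * expectation (f k)"
    unfolding exp_eq using int_f by (simp add: prob_space)
  also have "ennreal (1 - s k * expectation (f k)) < 1"
    using k s(1)[of k] by (subst ennreal_less_one_iff) simp
  finally show ?thesis by (rule that[OF s(1)])
qed

text \<open>Independence factorises the expectation and equal laws make the factors equal.\<close>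

lemma nn_integral_exp_sum:
  assumes "finite A"
  shows "(\<integral>\<^sup>+\<omega>. ennreal (exp (- t * real_of_int (\<Sum>i\<in>A. X i \<omega>))) \<partial>M) =
    (\<integral>\<^sup>+\<omega>. ennreal (exp (- t * real_of_int (X 0 \<omega>))) \<partial>M) ^ card A"
proof -
  let ?e = "\<lambda>c. ennreal (exp (- t * real_of_int c))"
  have "(\<integral>\<^sup>+\<omega>. ?e (\<Sum>i\<in>A. X i \<omega>) \<partial>M) = (\<integral>\<^sup>+\<omega>. (\<Prod>i\<in>A. ?e (X i \<omega>)) \<partial>M)"
    using assms by (simp add: prod_ennreal exp_sum sum_distrib_left flip: sum_negf)
  also have "\<dots> = (\<Prod>i\<in>A. \<integral>\<^sup>+\<omega>. ?e (X i \<omega>) \<partial>M)"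
  proof (rule indep_vars_nn_integral[OF assms])
    have "indep_vars (\<lambda>_. borel) (\<lambda>i \<omega>. ?e (X i \<omega>)) UNIV"
      by (rule indep_vars_compose2[OF independent]) simp
    then show "indep_vars (\<lambda>_. borel) (\<lambda>i \<omega>. ?e (X i \<omega>)) A" by (rule indep_vars_subset) simp
  qed simp
  also have "\<dots> = (\<Prod>i\<in>A. \<integral>\<^sup>+\<omega>. ?e (X 0 \<omega>) \<partial>M)"
  proof (rule prod.cong[OF refl])
    fix i
    show "(\<integral>\<^sup>+\<omega>. ?e (X i \<omega>) \<partial>M) = (\<integral>\<^sup>+\<omega>. ?e (X 0 \<omega>) \<partial>M)"
      using nn_integral_distr[OF X_measurable[of i], of ?e]
        nn_integral_distr[OF X_measurable[of 0], of ?e]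
      by (simp add: identically_distributed[of i])
  qed
  finally show ?thesis by simp
qed

text \<open>The exponential moments of the sums form a convergent geometric series, so almost surely
  \<open>exp (- t * sum)\<close> tends to 0, and it is below 1 only for a positive sum. General
  index sets \<open>A n\<close> cover future and past blocks at once.\<close>

lemma AE_sum_eventually_pos:
  fixes A :: "nat \<Rightarrow> int set"
  assumes mean: "0 < expectation (\<lambda>\<omega>. real_of_int (X 0 \<omega>))"
    and A: "\<And>n. finite (A n)" "\<And>n. card (A n) = n"
  shows "AE \<omega> in M. \<forall>\<^sub>F n in sequentially. 0 < (\<Sum>i\<in>A n. X i \<omega>)"
proof -
  obtain t where t: "0 < t" "(\<integral>\<^sup>+\<omega>. ennreal (exp (- t * real_of_int (X 0 \<omega>))) \<partial>M) < 1"
    using exp_moment_less_1[OF mean] .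
  define e where "e n \<omega> = exp (- t * real_of_int (\<Sum>i\<in>A n. X i \<omega>))" for n \<omega>
  have sum_meas: "(\<lambda>\<omega>. \<Sum>i\<in>A n. X i \<omega>) \<in> M \<rightarrow>\<^sub>M count_space UNIV" for n
    by (rule measurable_compose[OF increments_measurable measurable_coordinate_sum[OF A(1)]])
  have [measurable]: "(\<lambda>\<omega>. ennreal (e n \<omega>)) \<in> borel_measurable M" for n
    unfolding e_def by (rule measurable_compose[OF sum_meas]) simp
  define c where "c = enn2real (\<integral>\<^sup>+\<omega>. ennreal (exp (- t * real_of_int (X 0 \<omega>))) \<partial>M)"
  have c: "(\<integral>\<^sup>+\<omega>. ennreal (exp (- t * real_of_int (X 0 \<omega>))) \<partial>M) = ennreal c" "0 \<le> c" "c < 1"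
  proof -
    show "0 \<le> c" by (simp add: c_def)
    show eq: "(\<integral>\<^sup>+\<omega>. ennreal (exp (- t * real_of_int (X 0 \<omega>))) \<partial>M) = ennreal c"
      unfolding c_def using t(2) by (intro ennreal_enn2real[symmetric]) (auto intro: less_trans)
    show "c < 1" using t(2) \<open>0 \<le> c\<close> unfolding eq by (subst (asm) ennreal_less_one_iff)
  qed
  have "(\<integral>\<^sup>+\<omega>. (\<Sum>n. ennreal (e n \<omega>)) \<partial>M) = (\<Sum>n. \<integral>\<^sup>+\<omega>. ennreal (e n \<omega>) \<partial>M)"
    by (rule nn_integral_suminf) simp
  also have "\<dots> = (\<Sum>n. ennreal (c ^ n))"
    unfolding e_def by (simp only: nn_integral_exp_sum[OF A(1)] A(2) c ennreal_power)
  also have "\<dots> = ennreal (\<Sum>n. c ^ n)"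
    using c by (intro suminf_ennreal2) (auto intro: summable_geometric)
  finally have "(\<integral>\<^sup>+\<omega>. (\<Sum>n. ennreal (e n \<omega>)) \<partial>M) \<noteq> \<infinity>" by simp
  then have "AE \<omega> in M. (\<Sum>n. ennreal (e n \<omega>)) \<noteq> \<infinity>"
    by (intro nn_integral_PInf_AE) simp_all
  then show ?thesis
  proof eventually_elim
    fix \<omega> assume "(\<Sum>n. ennreal (e n \<omega>)) \<noteq> \<infinity>"
    then have "summable (\<lambda>n. e n \<omega>)"
      by (intro summable_suminf_not_top) (simp_all add: e_def)
    then have "(\<lambda>n. e n \<omega>) \<longlonglongrightarrow> 0" by (rule summable_LIMSEQ_zero)
    then have "\<forall>\<^sub>F n in sequentially. e n \<omega> < 1" by (rule order_tendstoD) simp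
    then show "\<forall>\<^sub>F n in sequentially. 0 < (\<Sum>i\<in>A n. X i \<omega>)"
    proof eventually_elim
      case (elim n)
      then show ?case using t(1) by (simp add: e_def zero_less_mult_iff flip: of_int_sum)
    qed
  qed
qed

lemma AE_record_walk:
  assumes mean: "0 < expectation (\<lambda>\<omega>. real_of_int (X 0 \<omega>))"
  shows "AE \<omega> in M. record_walk (increments \<omega>)"
proof -
  have "AE \<omega> in M. \<forall>i. \<forall>\<^sub>F n in sequentially. 0 < (\<Sum>l\<in>{i..<i + int n}. X l \<omega>)"
    unfolding AE_all_countable by (intro allI AE_sum_eventually_pos mean) simp_all
  moreover have "AE \<omega> in M. \<forall>i. \<forall>\<^sub>F n in sequentially. 0 < (\<Sum>l\<in>{i - int n..<i}. X l \<omega>)"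
    unfolding AE_all_countable by (intro allI AE_sum_eventually_pos mean) simp_all
  ultimately show ?thesis
  proof eventually_elim
    case (elim \<omega>)
    show ?case
    proof
      fix i
      obtain N where N: "\<And>n. N \<le> n \<Longrightarrow> 0 < (\<Sum>l\<in>{i..<i + int n}. X l \<omega>)"
        using elim(1) unfolding eventually_sequentially by blast
      \<comment> \<open>\<open>Suc N\<close> instead of \<open>N\<close> keeps the block nonempty
        when \<open>N = 0\<close>.\<close>
      have "i + int (Suc N) > i" "0 \<le> (\<Sum>l\<in>{i..<i + int (Suc N)}. X l \<omega>)"
        using N[of "Suc N"] by simp_all
      then show "\<exists>j>i. 0 \<le> (\<Sum>l\<in>{i..<j}. X l \<omega>)" by blast
    next
      fix i
      obtain N where N: "\<And>n. N \<le> n \<Longrightarrow> 0 < (\<Sum>l\<in>{i - int n..<i}. X l \<omega>)"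
        using elim(2) unfolding eventually_sequentially by blast
      let ?s = "\<lambda>l. \<Sum>l\<in>{l..<i}. X l \<omega>"
      \<comment> \<open>Blocks starting before \<open>i - int N\<close> have positive sums, hence
        the inserted 0; the remaining starting points are finitely many.\<close>
      define K where "K = Min (insert 0 (?s ` {i - int N..i}))"
      have "K \<le> ?s l" if "l \<le> i" for l
      proof (cases "i - int N \<le> l")
        case True
        then show ?thesis using that unfolding K_def by (intro Min_le) auto
      next
        case False
        then have "0 < ?s l" using N[of "nat (i - l)"] by auto
        moreover have "K \<le> 0" unfolding K_def by (intro Min_le) auto
        ultimately show ?thesis by simp
      qed
      then show "\<exists>K. \<forall>l\<le>i. K \<le> (\<Sum>l\<in>{l..<i}. X l \<omega>)" by blast
    qed
  qed
qed

text \<open>Every vertex almost surely sends mass 1, to its unique spine point. Hence 0 receives at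
  most 1 in expectation and almost surely a finite mass, which is the number of vertices with spine
  point 0.\<close>

lemma AE_finite_spine_fiber:
  assumes mean: "0 < expectation (\<lambda>\<omega>. real_of_int (X 0 \<omega>))"
  shows "AE \<omega> in M. \<forall>v. finite {u. spine_point (increments \<omega>) u v}"
proof -
  define f :: "(int \<Rightarrow> int) \<Rightarrow> int \<Rightarrow> int \<Rightarrow> ennreal"
    where "f x u v = indicator {u. spine_point x u v} u" for x u v
  have f_meas [measurable]: "(\<lambda>x. f x u v) \<in> borel_measurable increment_space" for u v
  proof -
    have "(\<lambda>x. indicator {x. spine_point x u v} x :: ennreal) \<in> borel_measurable increment_space"
      by measurable
    then show ?thesis by (simp add: f_def indicator_def)
  qed
  have into: "(\<integral>\<^sup>+u. f x u v \<partial>count_space UNIV) =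
      emeasure (count_space UNIV) {u. spine_point x u v}" for x v
    unfolding f_def by (rule nn_integral_indicator) simp
  have "(\<integral>\<^sup>+\<omega>. \<integral>\<^sup>+u. f (increments \<omega>) u 0 \<partial>count_space UNIV \<partial>M) =
      (\<integral>\<^sup>+\<omega>. \<integral>\<^sup>+v. f (increments \<omega>) 0 v \<partial>count_space UNIV \<partial>M)"
    by (rule mass_transport_increments[symmetric])
      (simp_all add: f_def spine_point_shift indicator_def)
  also have "\<dots> \<le> (\<integral>\<^sup>+\<omega>. 1 \<partial>M)"
  proof (rule nn_integral_mono_AE, use AE_record_walk[OF mean] in eventually_elim)
    case (elim \<omega>)
    interpret record_walk "increments \<omega>" by (rule elim)
    obtain v where v: "spine_point (increments \<omega>) 0 v" using ex_spine_point by blast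
    have "(\<integral>\<^sup>+w. f (increments \<omega>) 0 w \<partial>count_space UNIV) =
        (\<integral>\<^sup>+w. indicator {v} w \<partial>count_space UNIV)"
      using v spine_point_unique by (intro nn_integral_cong) (auto simp: f_def indicator_def)
    then show ?case by simp
  qed
  finally have "(\<integral>\<^sup>+\<omega>. \<integral>\<^sup>+u. f (increments \<omega>) u 0 \<partial>count_space UNIV \<partial>M) \<le> 1"
    by (simp add: emeasure_space_1)
  moreover have [measurable]: "(\<lambda>x. \<integral>\<^sup>+u. f x u 0 \<partial>count_space UNIV) \<in> borel_measurable increment_space"
    by (rule borel_measurable_nn_integral_count_space) simp
  ultimately have "AE \<omega> in M. (\<integral>\<^sup>+u. f (increments \<omega>) u 0 \<partial>count_space UNIV) \<noteq> \<infinity>"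
    by (intro nn_integral_PInf_AE) (auto simp: top_unique)
  \<comment> \<open>Stationarity carries the finiteness from 0 to every vertex \<open>k\<close>;
    there are countably many, so one null set suffices.\<close>
  then have "AE \<omega> in M. (\<integral>\<^sup>+u. f (shift_seq k (increments \<omega>)) u 0 \<partial>count_space UNIV) \<noteq> \<infinity>" for k
    by (rule AE_shift) measurable
  then have "AE \<omega> in M. \<forall>k. (\<integral>\<^sup>+u. f (shift_seq k (increments \<omega>)) u 0 \<partial>count_space UNIV) \<noteq> \<infinity>"
    by (simp add: AE_all_countable)
  then show ?thesis
  proof eventually_elim
    case (elim \<omega>)
    show ?case
    proof
      fix v
      have "finite {u. spine_point (increments \<omega>) (u + v) v}"
        using elim[rule_format, of v] unfolding into
        by (auto simp: spine_point_shift emeasure_count_space split: if_splits)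
      then have "finite ((\<lambda>u. u + v) ` {u. spine_point (increments \<omega>) (u + v) v})"
        by (rule finite_imageI)
      moreover have "{u. spine_point (increments \<omega>) u v} \<subseteq>
          (\<lambda>u. u + v) ` {u. spine_point (increments \<omega>) (u + v) v}"
        by (auto intro: image_eqI[of _ _ "_ - v"])
      ultimately show "finite {u. spine_point (increments \<omega>) u v}" by (rule finite_subset[rotated])
    qed
  qed
qed

text \<open>On the almost sure event the component of 0 is the whole record graph, so the
  deterministic results apply to it.\<close>

lemma AE_connected_class_I_F:
  assumes mean: "0 < expectation (\<lambda>\<omega>. real_of_int (X 0 \<omega>))"
  shows "AE \<omega> in M. Digraph_Component.connected (record_graph (increments \<omega>)) \<and>
    class_I_F (component_of (record_graph (increments \<omega>)) 0)"
  using AE_record_walk[OF mean] AE_finite_spine_fiber[OF mean]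
proof eventually_elim
  case (elim \<omega>)
  interpret record_walk "increments \<omega>" by (rule elim)
  show ?case
    using connected_record_graph class_I_F_record_graph elim(2)
    by (simp add: component_eq_record_graph)
qed

end

theorem proposition41:
  fixes M :: "'w measure" and X :: "int \<Rightarrow> 'w \<Rightarrow> int"
  assumes "skip_free_increments M X"
    and "0 < (\<integral>\<omega>. real_of_int (X 0 \<omega>) \<partial>M)"
  shows "unimodular M (\<lambda>\<omega>. component_of (record_graph (\<lambda>n. X n \<omega>)) 0) 0 \<and>
    (AE \<omega> in M. Digraph_Component.connected (record_graph (\<lambda>n. X n \<omega>)) \<and>
       class_I_F (component_of (record_graph (\<lambda>n. X n \<omega>)) 0))"
  using skip_free_increments.unimodular_component[OF assms(1)]
    skip_free_increments.AE_connected_class_I_F[OF assms]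
  by blast

end
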